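(* Let $n\ge 1$ be an integer, $\mathcal{V}=\{1,\ldots,n\}$, let $r_i\in(0,1]$ for $i\in\mathcal{V}$, and let $r=\min_{i\in\mathcal{V}}r_i$. Let $x(t)=(x_1(t),\ldots,x_n(t))$, $t=0,1,2,\ldots$, be the trajectory of the heterogeneous Hegselmann-Krause system with confidence bounds $r_1,\ldots,r_n$ started from any initial opinions $x(0)\in[0,1]^n$. Then there exist $c,c'\in[0,1]$ with $c\le c'$, subsets $\mathcal{C},\mathcal{C}'\subseteq\mathcal{V}$ with $|\mathcal{C}|\ge 1$ and $|\mathcal{C}'|\ge 1$, and a time $t^*\ge 0$, such that: (a) $x_i(t)=c$ and $x_j(t)=c'$ for all $i\in\mathcal{C}$, $j\in\mathcal{C}'$ and $t\ge t^*$; (b) if $c'-c\le 2r$, then the system converges in finite time (i.e. the opinion of every agent converges in finite time); (c) if $c'-c>2r$, then $x_k(t)-c>r$ and $c'-x_k(t)>r$ for all $k\in\mathcal{V}\setminus(\mathcal{C}\cup\mathcal{C}')$ and all $t\ge t^*$.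
   Context: Heterogeneous Hegselmann-Krause (HK) system: there are $n$ agents $\mathcal{V}=\{1,\ldots,n\}$; agent $i$ has confidence bound $r_i\in(0,1]$ and opinion $x_i(t)\in[0,1]$ at integer time $t\ge 0$. Given $x(0)\in[0,1]^n$, the opinions evolve synchronously by $$x_i(t+1)=\frac{1}{|\mathcal{N}_i(x(t))|}\sum_{j\in\mathcal{N}_i(x(t))}x_j(t),\qquad i\in\mathcal{V},$$ where $\mathcal{N}_i(x(t))=\{1\le j\le n : |x_j(t)-x_i(t)|\le r_i\}$ (so $i\in\mathcal{N}_i(x(t))$). The opinion $x_i(t)$ of agent $i$ converges in finite time if there exist $x_i^*\in[0,1]$ and a time $T\ge 0$ such that $x_i(t)=x_i^*$ for all $t\ge T$. The system converges in finite time if the opinion of every agent $i\in\mathcal{V}$ converges in finite time. *)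

theory Defs
  imports Complex_Main
begin

text \<open>
  Agents are the natural numbers in \<open>{1..n}\<close>. An opinion profile is a function \<open>nat \<Rightarrow> real\<close>, of
  which only the values on \<open>{1..n}\<close> matter; likewise for the confidence bounds \<open>r\<close>. A trajectory
  takes the time as its first argument: \<open>x t i\<close> is the opinion of agent \<open>i\<close> at time \<open>t\<close>.
\<close>

definition hk_neighbours :: "nat \<Rightarrow> (nat \<Rightarrow> real) \<Rightarrow> (nat \<Rightarrow> real) \<Rightarrow> nat \<Rightarrow> nat set" where
  "hk_neighbours n r y i = {j \<in> {1..n}. \<bar>y j - y i\<bar> \<le> r i}"

definition hk_trajectory :: "nat \<Rightarrow> (nat \<Rightarrow> real) \<Rightarrow> (nat \<Rightarrow> nat \<Rightarrow> real) \<Rightarrow> bool" where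
  "hk_trajectory n r x \<longleftrightarrow>
     (\<forall>i\<in>{1..n}. x 0 i \<in> {0..1}) \<and>
     (\<forall>t. \<forall>i\<in>{1..n}.
        x (Suc t) i =
          1 / real (card (hk_neighbours n r (x t) i)) * (\<Sum>j\<in>hk_neighbours n r (x t) i. x t j))"

definition opinion_converges_finite_time :: "(nat \<Rightarrow> nat \<Rightarrow> real) \<Rightarrow> nat \<Rightarrow> bool" where
  "opinion_converges_finite_time x i \<longleftrightarrow> (\<exists>l\<in>{0..1}. \<exists>T. \<forall>t\<ge>T. x t i = l)"

definition system_converges_finite_time :: "nat \<Rightarrow> (nat \<Rightarrow> nat \<Rightarrow> real) \<Rightarrow> bool" where
  "system_converges_finite_time n x \<longleftrightarrow> (\<forall>i\<in>{1..n}. opinion_converges_finite_time x i)"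

end

theory Submission
  imports Defs
begin

text \<open>
  The minimal opinion is nondecreasing and bounded, so it converges; let \<open>s\<close> be slightly below its
  limit. An agent whose next opinion is close to \<open>s\<close> can average only over opinions close to \<open>s\<close>,
  because eventually no opinion is below \<open>s\<close>, and an average over at most \<open>n\<close> terms controls each term up to a
  factor \<open>n\<close> (\<open>hk_average_controls_neighbour\<close>). Applied to the agent attaining the next minimum,
  this shows that no opinion lies in an intermediate zone above \<open>s\<close>: an agent is either very close
  to \<open>s\<close> or more than the least confidence bound above it (\<open>hk_gap_above_minimum\<close>). Applied to any
  agent that is low at the next step, it shows that all its current neighbours are low
  (\<open>hk_low_agent_has_low_neighbours\<close>). So the set of low agents can only shrink and eventually
  stabilises. From then on each low agent has exactly the low agents as neighbours: they all jump to
  their common mean and stay there, and every other agent is out of their reach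
  (\<open>hk_lowest_cluster_freezes\<close>).

  The reflection \<open>y \<mapsto> 1 - y\<close> preserves the dynamics, so the highest opinions freeze in the same way,
  at some value \<open>c'\<close>. An agent outside both frozen clusters lies strictly between \<open>c\<close> and \<open>c'\<close>, at
  distance more than the least confidence bound from either. If \<open>c' - c\<close> is at most twice that bound,
  there is no room for such an agent, and the whole system is frozen.
\<close>

section \<open>Averaging over neighbours\<close>

lemma hk_neighbours_finite [simp]: "finite (hk_neighbours n r y i)"
  by (simp add: hk_neighbours_def)

lemma hk_neighbours_subset: "hk_neighbours n r y i \<subseteq> {1..n}"
  by (auto simp: hk_neighbours_def)

lemma hk_neighbours_card_le: "card (hk_neighbours n r y i) \<le> n"
  using card_mono[OF _ hk_neighbours_subset[of n r y i]] by simp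

lemma hk_neighbours_card_pos:
  assumes "i \<in> {1..n}" "0 \<le> r i"
  shows "card (hk_neighbours n r y i) > 0"
proof -
  have "i \<in> hk_neighbours n r y i" using assms by (simp add: hk_neighbours_def)
  then show ?thesis by (auto simp: card_gt_0_iff)
qed

lemma hk_step:
  assumes "hk_trajectory n r x" "i \<in> {1..n}"
  shows "x (Suc t) i =
    (\<Sum>j\<in>hk_neighbours n r (x t) i. x t j) / real (card (hk_neighbours n r (x t) i))"
  using assms by (simp add: hk_trajectory_def)

lemma hk_step_ge:
  assumes "hk_trajectory n r x" "i \<in> {1..n}" "0 \<le> r i"
    and "\<And>j. j \<in> {1..n} \<Longrightarrow> s \<le> x t j"
  shows "s \<le> x (Suc t) i"
proof -
  let ?N = "hk_neighbours n r (x t) i"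
  have "of_nat (card ?N) * s \<le> (\<Sum>j\<in>?N. x t j)"
    by (rule sum_bounded_below) (use assms(4) hk_neighbours_subset[of n r "x t" i] in blast)
  then show ?thesis
    using hk_step[OF assms(1,2), of t] hk_neighbours_card_pos[of i n r "x t"] assms(2,3)
    by (simp add: field_simps)
qed

text \<open>
  This transfers every statement about low opinions to high ones, since averaging commutes with affine
  maps and neighbourhoods only depend on distances.
\<close>
lemma hk_trajectory_reflect:
  assumes "hk_trajectory n r x" "\<forall>i\<in>{1..n}. 0 \<le> r i"
  shows "hk_trajectory n r (\<lambda>t i. 1 - x t i)"
proof -
  have same: "hk_neighbours n r (\<lambda>i. 1 - y i) i = hk_neighbours n r y i" for y i
    by (auto simp: hk_neighbours_def)
  have "1 - x (Suc t) i =
      1 / real (card (hk_neighbours n r (x t) i)) * (\<Sum>j\<in>hk_neighbours n r (x t) i. 1 - x t j)"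
    if i: "i \<in> {1..n}" for t i
  proof -
    have "real (card (hk_neighbours n r (x t) i)) \<noteq> 0"
      using hk_neighbours_card_pos[of i n r "x t"] i assms(2) by auto
    then show ?thesis
      by (simp only: hk_step[OF assms(1) i] sum_subtractf) (simp add: field_simps)
  qed
  with assms(1) show ?thesis
    by (simp add: hk_trajectory_def same)
qed

lemma hk_opinion_nonneg:
  assumes "hk_trajectory n r x" "\<forall>i\<in>{1..n}. 0 \<le> r i" "i \<in> {1..n}"
  shows "0 \<le> x t i"
  using assms(3)
proof (induction t arbitrary: i)
  case 0
  then show ?case using assms(1) by (simp add: hk_trajectory_def)
next
  case (Suc t)
  then show ?case using hk_step_ge[OF assms(1)] assms(2) by blast
qed

lemma hk_opinion_in_unit:
  assumes "hk_trajectory n r x" "\<forall>i\<in>{1..n}. 0 \<le> r i" "i \<in> {1..n}"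
  shows "x t i \<in> {0..1}"
  using hk_opinion_nonneg[OF assms]
    hk_opinion_nonneg[OF hk_trajectory_reflect[OF assms(1,2)] assms(2,3), of t] by simp

section \<open>Opinions near the limit of the minimum\<close>

text \<open>
  The minimal opinion is a bounded nondecreasing sequence, hence it is eventually confined to a window
  of any prescribed width.
\<close>
lemma hk_minimum_eventually_confined:
  assumes "n \<ge> 1" "hk_trajectory n r x" "\<forall>i\<in>{1..n}. 0 \<le> r i" "\<epsilon> > 0"
  shows "\<exists>s T. \<forall>t\<ge>T. (\<forall>j\<in>{1..n}. s \<le> x t j) \<and> (\<exists>j\<in>{1..n}. x t j \<le> s + \<epsilon>)"
proof -
  define m where "m t = Min (x t ` {1..n})" for t
  have m_le: "m t \<le> x t j" if "j \<in> {1..n}" for t j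
    unfolding m_def using that by (intro Min_le) auto
  have m_attained: "\<exists>j\<in>{1..n}. x t j = m t" for t
  proof -
    have "m t \<in> x t ` {1..n}"
      unfolding m_def using assms(1) by (intro Min_in) auto
    then show ?thesis by auto
  qed
  have "m t \<le> m (Suc t)" for t
  proof -
    obtain j where "j \<in> {1..n}" "x (Suc t) j = m (Suc t)" using m_attained by blast
    then show ?thesis using hk_step_ge[OF assms(2), of j "m t" t] assms(3) m_le by auto
  qed
  then have "incseq m" by (rule incseq_SucI)
  moreover have "m t \<le> 1" for t
  proof -
    obtain j where "j \<in> {1..n}" "x t j = m t" using m_attained by blast
    then show ?thesis using hk_opinion_in_unit[OF assms(2,3), of j t] by simp
  qed
  ultimately obtain c where c: "m \<longlonglongrightarrow> c" "\<And>t. m t \<le> c"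
    using incseq_convergent by metis
  from order_tendstoD(1)[OF c(1), of "c - \<epsilon>"] \<open>\<epsilon> > 0\<close>
  obtain T where T: "\<And>t. t \<ge> T \<Longrightarrow> c - \<epsilon> < m t"
    by (auto simp: eventually_sequentially)
  have "(\<forall>j\<in>{1..n}. c - \<epsilon> \<le> x t j) \<and> (\<exists>j\<in>{1..n}. x t j \<le> c - \<epsilon> + \<epsilon>)" if "t \<ge> T" for t
  proof
    show "\<forall>j\<in>{1..n}. c - \<epsilon> \<le> x t j"
      using T[OF that] m_le[of _ t] by fastforce
    show "\<exists>j\<in>{1..n}. x t j \<le> c - \<epsilon> + \<epsilon>"
      using m_attained[of t] c(2)[of t] by (metis diff_add_cancel)
  qed
  then show ?thesis by blast
qed

text \<open>
  The excesses over \<open>s\<close> are nonnegative, so each one is at most their sum, which is at most \<open>n\<close> times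
  their mean.
\<close>
lemma hk_average_controls_neighbour:
  assumes "hk_trajectory n r x" "i \<in> {1..n}" "0 \<le> r i"
    and low: "\<And>j. j \<in> {1..n} \<Longrightarrow> s \<le> x t j"
    and next_low: "x (Suc t) i \<le> s + a"
    and j: "j \<in> hk_neighbours n r (x t) i"
  shows "x t j \<le> s + real n * a"
proof -
  let ?N = "hk_neighbours n r (x t) i"
  have pos: "real (card ?N) > 0"
    using hk_neighbours_card_pos assms(2,3) by simp
  have "s \<le> x (Suc t) i" using hk_step_ge[of n r x i s t] assms by blast
  then have "0 \<le> a" using next_low by linarith
  have "x t j - s \<le> (\<Sum>k\<in>?N. x t k - s)"
    by (rule member_le_sum) (use j low hk_neighbours_subset[of n r "x t" i] in auto)
  also have "\<dots> = real (card ?N) * (x (Suc t) i - s)"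
    using pos by (simp add: hk_step[OF assms(1,2)] sum_subtractf field_simps)
  also have "\<dots> \<le> real (card ?N) * a"
    using next_low pos by (intro mult_left_mono) auto
  also have "\<dots> \<le> real n * a"
    using hk_neighbours_card_le \<open>0 \<le> a\<close> by (intro mult_right_mono) auto
  finally show ?thesis by simp
qed

text \<open>
  The agent \<open>i\<close> attaining the next minimum sees every opinion up to \<open>s + \<rho>\<close>, yet its average is at
  most \<open>s + \<epsilon>\<close>; so whatever it sees is already at most \<open>s + n\<epsilon>\<close>.
\<close>
lemma hk_gap_above_minimum:
  assumes "hk_trajectory n r x"
    and r: "0 < \<rho>" "\<forall>i\<in>{1..n}. \<rho> \<le> r i"
    and low: "\<And>j. j \<in> {1..n} \<Longrightarrow> s \<le> x t j"
    and next_min: "\<exists>i\<in>{1..n}. x (Suc t) i \<le> s + \<epsilon>"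
    and small: "real n * \<epsilon> \<le> \<rho>"
    and j: "j \<in> {1..n}" "x t j \<le> s + \<rho>"
  shows "x t j \<le> s + real n * \<epsilon>"
proof -
  from next_min obtain i where i: "i \<in> {1..n}" "x (Suc t) i \<le> s + \<epsilon>" by blast
  have ri: "0 \<le> r i" "\<rho> \<le> r i" using r i(1) by force+
  have "x t k \<le> s + real n * \<epsilon>" if "k \<in> hk_neighbours n r (x t) i" for k
    using hk_average_controls_neighbour[of n r x i s t \<epsilon> k] assms(1) i ri(1) low that by blast
  note nb = this
  have "i \<in> hk_neighbours n r (x t) i" using i ri by (simp add: hk_neighbours_def)
  from nb[OF this] have "\<bar>x t j - x t i\<bar> \<le> \<rho>"
    using low[OF i(1)] low[OF j(1)] j(2) small by linarith
  then have "j \<in> hk_neighbours n r (x t) i"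
    using j(1) ri by (simp add: hk_neighbours_def)
  then show ?thesis by (rule nb)
qed

text \<open>
  By the gap at time \<open>Suc t\<close>, a low agent is then within \<open>n\<epsilon>\<close> of \<open>s\<close>, so its neighbours at time \<open>t\<close>
  are within \<open>n\<^sup>2\<epsilon>\<close> of \<open>s\<close>. This is what dictates the smallness required of \<open>\<epsilon>\<close>.
\<close>
lemma hk_low_agent_has_low_neighbours:
  assumes "hk_trajectory n r x"
    and r: "0 < \<rho>" "\<forall>i\<in>{1..n}. \<rho> \<le> r i"
    and low: "\<And>t j. t \<ge> T \<Longrightarrow> j \<in> {1..n} \<Longrightarrow> s \<le> x t j"
    and minimum: "\<And>t. t \<ge> T \<Longrightarrow> \<exists>i\<in>{1..n}. x t i \<le> s + \<epsilon>"
    and small: "real n * \<epsilon> \<le> \<rho>" "real n * (real n * \<epsilon>) \<le> \<rho>"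
    and t: "t \<ge> T"
    and i: "i \<in> {1..n}" "x (Suc t) i \<le> s + \<rho>"
    and j: "j \<in> hk_neighbours n r (x t) i"
  shows "x t j \<le> s + \<rho>"
proof -
  have "x (Suc t) i \<le> s + real n * \<epsilon>"
    by (rule hk_gap_above_minimum[OF assms(1) r])
      (use low minimum t i small(1) in auto)
  then have "x t j \<le> s + real n * (real n * \<epsilon>)"
    using hk_average_controls_neighbour[of n r x i s t "real n * \<epsilon>" j]
      assms(1) i(1) r low[OF t] j by fastforce
  then show ?thesis using small(2) by linarith
qed

section \<open>Freezing of the extreme clusters\<close>

lemma decreasing_finite_sets_stabilise:
  fixes A :: "nat \<Rightarrow> 'a set"
  assumes fin: "\<And>t. finite (A t)"
    and dec: "\<And>t. t \<ge> T \<Longrightarrow> A (Suc t) \<subseteq> A t"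
  shows "\<exists>T'\<ge>T. \<forall>t\<ge>T'. A t = A T'"
proof -
  obtain T' where T': "T' \<ge> T" "\<And>t. t \<ge> T \<Longrightarrow> card (A T') \<le> card (A t)"
    using ex_has_least_nat[of "\<lambda>t. t \<ge> T" T "\<lambda>t. card (A t)"] by auto
  have "A t = A T'" if "t \<ge> T'" for t
  proof -
    have "A t \<subseteq> A T'"
      using that
    proof (induction rule: dec_induct)
      case (step k)
      then show ?case using dec[of k] T'(1) by auto
    qed simp
    then show ?thesis
      using card_seteq[OF fin] T' that by (meson order_trans)
  qed
  with T'(1) show ?thesis by blast
qed

text \<open>
  Once the set of low agents is constant, it is the neighbourhood of each of its members: it contains
  their neighbours, because they are still low at the next step, and its diameter is at most \<open>\<rho>\<close>. Hence
  its members share one next opinion, and agents outside, not being neighbours, are out of reach.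
  The frozen value \<open>c\<close> is then automatically the minimal opinion.
\<close>
lemma hk_lowest_cluster_freezes:
  assumes "n \<ge> 1" "hk_trajectory n r x"
    and r: "0 < \<rho>" "\<forall>i\<in>{1..n}. \<rho> \<le> r i"
  shows "\<exists>c\<in>{0..1}. \<exists>C T. C \<subseteq> {1..n} \<and> C \<noteq> {} \<and>
    (\<forall>t\<ge>T. (\<forall>i\<in>C. x t i = c) \<and> (\<forall>k\<in>{1..n} - C. x t k - c > \<rho>))"
proof -
  have r0: "\<forall>i\<in>{1..n}. 0 \<le> r i" using r by force
  \<comment> \<open>Chosen so that two applications of the averaging bound, each costing a factor \<open>n\<close>, end at \<open>\<rho>\<close>.\<close>
  define \<epsilon> where "\<epsilon> = \<rho> / (real n * real n)"
  have n: "real n \<ge> 1" using assms(1) by simp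
  have "\<epsilon> > 0" using n r(1) by (simp add: \<epsilon>_def)
  have small2: "real n * (real n * \<epsilon>) \<le> \<rho>" using n by (simp add: \<epsilon>_def)
  have "1 * (real n * \<epsilon>) \<le> real n * (real n * \<epsilon>)"
    using n \<open>\<epsilon> > 0\<close> by (intro mult_right_mono) auto
  then have small1: "real n * \<epsilon> \<le> \<rho>" using small2 by linarith
  have "1 * \<epsilon> \<le> real n * \<epsilon>" using n \<open>\<epsilon> > 0\<close> by (intro mult_right_mono) auto
  then have small0: "\<epsilon> \<le> \<rho>" using small1 by linarith
  obtain s T0 where low: "\<And>t j. t \<ge> T0 \<Longrightarrow> j \<in> {1..n} \<Longrightarrow> s \<le> x t j"
    and minimum: "\<And>t. t \<ge> T0 \<Longrightarrow> \<exists>j\<in>{1..n}. x t j \<le> s + \<epsilon>"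
    using hk_minimum_eventually_confined[OF assms(1,2) r0 \<open>\<epsilon> > 0\<close>] by blast
  define A where "A t = {j \<in> {1..n}. x t j \<le> s + \<rho>}" for t
  have neighbours_low: "hk_neighbours n r (x t) i \<subseteq> A t" if "t \<ge> T0" "i \<in> A (Suc t)" for t i
    using hk_low_agent_has_low_neighbours[OF assms(2) r low minimum small1 small2]
      that hk_neighbours_subset[of n r "x t" i]
    by (auto simp: A_def)
  have "A (Suc t) \<subseteq> A t" if "t \<ge> T0" for t
  proof
    fix i assume i: "i \<in> A (Suc t)"
    then have "i \<in> hk_neighbours n r (x t) i" using r0 by (auto simp: A_def hk_neighbours_def)
    then show "i \<in> A t" using neighbours_low[OF that i] by blast
  qed
  moreover have "finite (A t)" for t by (simp add: A_def)
  ultimately obtain T where T: "T \<ge> T0" "\<And>t. t \<ge> T \<Longrightarrow> A t = A T"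
    using decreasing_finite_sets_stabilise[of A T0] by blast
  define C where "C = A T"
  have C_sub: "C \<subseteq> {1..n}" by (auto simp: C_def A_def)
  have C_ne: "C \<noteq> {}"
    using minimum[OF T(1)] small0 by (fastforce simp: C_def A_def)
  have C_iff: "j \<in> C \<longleftrightarrow> x t j \<le> s + \<rho>" if "t \<ge> T" "j \<in> {1..n}" for t j
    using T(2)[OF that(1)] that(2) by (auto simp: C_def A_def)
  have neighbours: "hk_neighbours n r (x t) i = C" if t: "t \<ge> T" and i: "i \<in> C" for t i
  proof
    have "i \<in> A (Suc t)" using T(2)[of "Suc t"] t i by (simp add: C_def)
    from neighbours_low[OF _ this] show "hk_neighbours n r (x t) i \<subseteq> C"
      using T(1) T(2)[OF t] t by (simp add: C_def)
    show "C \<subseteq> hk_neighbours n r (x t) i"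
    proof
      fix j assume j: "j \<in> C"
      have "s \<le> x t i" "s \<le> x t j" "x t i \<le> s + \<rho>" "x t j \<le> s + \<rho>" "\<rho> \<le> r i"
        using C_iff[OF t, of i] C_iff[OF t, of j] low[of t] T(1) t i j C_sub r(2) by auto
      then show "j \<in> hk_neighbours n r (x t) i"
        using j C_sub by (auto simp: hk_neighbours_def)
    qed
  qed
  have mean: "x (Suc t) i = (\<Sum>j\<in>C. x t j) / real (card C)" if "t \<ge> T" "i \<in> C" for t i
    using hk_step[OF assms(2), of i t] neighbours[OF that] that(2) C_sub by auto
  define c where "c = (\<Sum>j\<in>C. x T j) / real (card C)"
  have card_C: "card C > 0"
    using C_ne C_sub finite_subset by (auto simp: card_gt_0_iff)
  \<comment> \<open>After one step the members of \<open>C\<close> agree, and a mean of equal opinions is that opinion.\<close>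
  have frozen: "x t i = c" if "t \<ge> Suc T" "i \<in> C" for t i
    using that
  proof (induction t arbitrary: i rule: dec_induct)
    case base
    then show ?case using mean[of T] by (simp add: c_def)
  next
    case (step t)
    then show ?case using mean[of t i] card_C by simp
  qed
  obtain i where i: "i \<in> C" using C_ne by blast
  then have i_n: "i \<in> {1..n}" using C_sub by blast
  have "c \<in> {0..1}"
    using hk_opinion_in_unit[OF assms(2) r0 i_n, of "Suc T"] frozen[OF _ i] by simp
  moreover have "x t k - c > \<rho>" if t: "t \<ge> Suc T" and k: "k \<in> {1..n} - C" for t k
  proof -
    have "k \<notin> hk_neighbours n r (x t) i" using neighbours[of t i] t i k by simp
    then have "\<bar>x t k - x t i\<bar> > r i" using k by (auto simp: hk_neighbours_def)
    moreover have "x t i \<le> x t k"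
      using C_iff[of t i] C_iff[of t k] t i i_n k by auto
    moreover have "\<rho> \<le> r i" using r(2) i_n by blast
    ultimately show ?thesis using frozen[OF t i] by linarith
  qed
  ultimately show ?thesis
    using C_sub C_ne frozen
    by (intro bexI[of _ c] exI[of _ C] exI[of _ "Suc T"] conjI allI impI ballI)
qed

theorem theorem3p1:
  fixes n :: nat and r :: "nat \<Rightarrow> real" and rmin :: real and x :: "nat \<Rightarrow> nat \<Rightarrow> real"
  assumes "n \<ge> 1"
    and "\<And>i. i \<in> {1..n} \<Longrightarrow> r i \<in> {0<..1}"
    and "rmin = Min (r ` {1..n})"
    and "hk_trajectory n r x"
  shows "\<exists>c\<in>{0..1}. \<exists>c'\<in>{0..1}. \<exists>C C' :: nat set. \<exists>t0 :: nat.
           c \<le> c' \<and>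
           C \<subseteq> {1..n} \<and> C' \<subseteq> {1..n} \<and> card C \<ge> 1 \<and> card C' \<ge> 1 \<and>
           (\<forall>i\<in>C. \<forall>j\<in>C'. \<forall>t\<ge>t0. x t i = c \<and> x t j = c') \<and>
           (c' - c \<le> 2 * rmin \<longrightarrow> system_converges_finite_time n x) \<and>
           (c' - c > 2 * rmin \<longrightarrow>
              (\<forall>k\<in>{1..n} - (C \<union> C'). \<forall>t\<ge>t0. x t k - c > rmin \<and> c' - x t k > rmin))"
proof -
  have rmin_le: "\<forall>i\<in>{1..n}. rmin \<le> r i"
    unfolding assms(3) by simp
  have "rmin \<in> r ` {1..n}"
    unfolding assms(3) using assms(1) by (intro Min_in) auto
  then have rmin_pos: "0 < rmin" using assms(2) by auto
  have r0: "\<forall>i\<in>{1..n}. 0 \<le> r i" using assms(2) by (simp add: less_imp_le)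
  obtain c C T where C: "c \<in> {0..1}" "C \<subseteq> {1..n}" "C \<noteq> {}"
    and c: "\<And>t i. t \<ge> T \<Longrightarrow> i \<in> C \<Longrightarrow> x t i = c"
    and above: "\<And>t k. t \<ge> T \<Longrightarrow> k \<in> {1..n} - C \<Longrightarrow> x t k - c > rmin"
    using hk_lowest_cluster_freezes[OF assms(1,4) rmin_pos rmin_le] by blast
  obtain d C' T' where C': "d \<in> {0..1}" "C' \<subseteq> {1..n}" "C' \<noteq> {}"
    and d: "\<And>t i. t \<ge> T' \<Longrightarrow> i \<in> C' \<Longrightarrow> 1 - x t i = d"
    and below: "\<And>t k. t \<ge> T' \<Longrightarrow> k \<in> {1..n} - C' \<Longrightarrow> 1 - x t k - d > rmin"
    using hk_lowest_cluster_freezes[OF assms(1) hk_trajectory_reflect[OF assms(4) r0]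
        rmin_pos rmin_le] by blast
  define c' where "c' = 1 - d"
  define t0 where "t0 = max T T'"
  have c_t0: "x t i = c" if "t \<ge> t0" "i \<in> C" for t i
    using c that by (simp add: t0_def)
  have c'_t0: "x t i = c'" if "t \<ge> t0" "i \<in> C'" for t i
    using d[of t i] that by (simp add: t0_def c'_def)
  have between: "x t k - c > rmin \<and> c' - x t k > rmin"
    if "k \<in> {1..n} - (C \<union> C')" "t \<ge> t0" for t k
    using above[of t k] below[of t k] that by (simp add: t0_def c'_def)
  have "c \<le> c'"
  proof -
    obtain j where j: "j \<in> C'" using C'(3) by blast
    have "x t0 j = c'" using c'_t0 j by simp
    moreover have "c \<le> x t0 j"
      using c_t0[of t0 j] above[of t0 j] rmin_pos j C'(2) by (cases "j \<in> C") (auto simp: t0_def)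
    ultimately show ?thesis by simp
  qed
  moreover have "c' \<in> {0..1}" using C'(1) by (simp add: c'_def)
  moreover have "card C \<ge> 1" "card C' \<ge> 1"
    using C(2,3) C'(2,3) finite_subset[of _ "{1..n}"]
    by (auto simp: Suc_le_eq card_gt_0_iff)
  moreover have "system_converges_finite_time n x" if close: "c' - c \<le> 2 * rmin"
    unfolding system_converges_finite_time_def opinion_converges_finite_time_def
  proof
    fix i assume i: "i \<in> {1..n}"
    have "i \<in> C \<union> C'"
    proof (rule ccontr)
      assume "i \<notin> C \<union> C'"
      with between[of i t0] i close show False by simp
    qed
    then show "\<exists>l\<in>{0..1}. \<exists>T. \<forall>t\<ge>T. x t i = l"
      using c_t0 c'_t0 C(1) \<open>c' \<in> {0..1}\<close> by blast
  qed
  ultimately show ?thesis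
    using C(1,2) C'(2) c_t0 c'_t0 between
    by (intro bexI[of _ c] bexI[of _ c'] exI[of _ C] exI[of _ C'] exI[of _ t0]) auto
qed

end
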